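(* Let $\Pi_t=\sigma_t(M_t)$, $t=0,\dots,T$, be an information state for the terminal-cost minimax control problem described in the context. Then, for all $t=0,\dots,T$, all $m_t\in\mathcal{M}_t$ and all $u_t\in\mathcal{U}_t$, $$Q_t(m_t,u_t)=\bar{Q}_t(\sigma_t(m_t),u_t)\quad\text{and}\quad V_t(m_t)=\bar{V}_t(\sigma_t(m_t)),$$ where $Q_t,V_t$ are the memory-based value functions and $\bar Q_t,\bar V_t$ are the information-state-based value functions defined in the context.
   Context: System. Fix a horizon $T\in\mathbb{N}$ and finite nonempty sets $\mathcal{X}_t,\mathcal{U}_t,\mathcal{W}_t,\mathcal{N}_t,\mathcal{Y}_t$ ($t=0,\dots,T$). The state evolves as $X_{t+1}=f_t(X_t,U_t,W_t)\in\mathcal{X}_{t+1}$ for $t=0,\dots,T-1$ from $X_0\in\mathcal{X}_0$, with disturbance $W_t\in\mathcal{W}_t$ and action $U_t\in\mathcal{U}_t$; the observation is $Y_t=h_t(X_t,N_t)\in\mathcal{Y}_t$ with noise $N_t\in\mathcal{N}_t$. The primitive variables $X_0,W_t,N_t$ are independent in the non-stochastic sense: their joint range is the full product $\mathcal{X}_0\times\prod_t\mathcal{W}_t\times\prod_t\mathcal{N}_t$. The memory at time $t$ is $M_t=(Y_{0:t},U_{0:t-1})$, where $Y_{0:t}=(Y_0,\dots,Y_t)$. The terminal cost is $c_T(X_T,U_T)$ with $c_T:\mathcal{X}_T\times\mathcal{U}_T\to\mathbb{R}_{\ge 0}$. Ranges. All quantities are uncertain variables, i.e. functions on a sample space $\Omega$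 without any probability distribution. Here $\Omega$ is the set of all tuples $\omega=(x_0,w_{0:T},n_{0:T},u_{0:T})$ with $x_0\in\mathcal{X}_0$, $w_t\in\mathcal{W}_t$, $n_t\in\mathcal{N}_t$, $u_t\in\mathcal{U}_t$ (actions arbitrary). The conditional range of $X$ given a realization $y$ of $Y$ is $[[X|y]]:=\{X(\omega): \omega\in\Omega,\ Y(\omega)=y\}$; similarly when conditioning on several realizations jointly. $\mathcal{M}_t$ is the set of realizations of $M_t$, $\mathcal{M}_t=\{M_t(\omega):\omega\in\Omega\}$. Memory-based value functions. $Q_T(m_T,u_T):=\max_{x_T\in[[X_T|m_T]]}c_T(x_T,u_T)$; for $t=0,\dots,T-1$, $Q_t(m_t,u_t):=\max_{m_{t+1}\in[[M_{t+1}|m_t,u_t]]}V_{t+1}(m_{t+1})$; and $V_t(m_t):=\min_{u_t\in\mathcal{U}_t}Q_t(m_t,u_t)$ for $t=0,\dots,T$. Information state. A family $\Pi_t=\sigma_t(M_t)$, $t=0,\dots,T$, with $\sigma_t:\mathcal{M}_t\to\mathcal{P}_t$ and $\mathcal{P}_t$ finite, is an information state if: (1) for all $m_T\in\mathcal{M}_T$, $u_T\in\mathcal{U}_T$, $\max_{x_T\in[[X_T|m_T]]}c_T(x_T,u_T)=\max_{x_T\in[[X_T|\sigma_T(m_T)]]}c_T(x_T,u_T)$, where $[[X_T|\pi_T]]$ denotes the conditional range of $X_T$ given $\Pi_T=\pi_T$; (2) for all $t=0,\dots,T-1$, $m_t\in\mathcal{M}_t$, $u_t\in\mathcal{U}_t$,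 $[[\Pi_{t+1}|m_t,u_t]]=[[\Pi_{t+1}|\sigma_t(m_t),u_t]]$, where the right-hand side conditions on $\Pi_t=\sigma_t(m_t)$ and $U_t=u_t$. Information-state value functions (for $\pi_t$ in the range of $\Pi_t$). $\bar Q_T(\pi_T,u_T):=\max_{x_T\in[[X_T|\pi_T]]}c_T(x_T,u_T)$; for $t=0,\dots,T-1$, $\bar Q_t(\pi_t,u_t):=\max_{\pi_{t+1}\in[[\Pi_{t+1}|\pi_t,u_t]]}\bar V_{t+1}(\pi_{t+1})$; and $\bar V_t(\pi_t):=\min_{u_t\in\mathcal{U}_t}\bar Q_t(\pi_t,u_t)$ for $t=0,\dots,T$. *)

theory Defs
  imports Complex_Main "HOL-Library.FuncSet"
begin

text \<open>
  The sets of states, actions, disturbances, noises and observations vary with time; each family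
  is represented by subsets of one common type. Values of the fields outside the times
  \<open>0, \<dots>, horizon\<close> (for the dynamics: \<open>0, \<dots>, horizon - 1\<close>) are irrelevant.
\<close>

record ('x, 'u, 'w, 'n, 'y) control_system =
  horizon :: nat
  states :: "nat \<Rightarrow> 'x set"
  actions :: "nat \<Rightarrow> 'u set"
  disturbances :: "nat \<Rightarrow> 'w set"
  noises :: "nat \<Rightarrow> 'n set"
  observations :: "nat \<Rightarrow> 'y set"
  dyn :: "nat \<Rightarrow> 'x \<Rightarrow> 'u \<Rightarrow> 'w \<Rightarrow> 'x"
  obs :: "nat \<Rightarrow> 'x \<Rightarrow> 'n \<Rightarrow> 'y"
  cost :: "'x \<Rightarrow> 'u \<Rightarrow> real"

definition valid_system :: "('x, 'u, 'w, 'n, 'y) control_system \<Rightarrow> bool" where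
  "valid_system S \<longleftrightarrow>
     (\<forall>t\<le>horizon S.
        finite (states S t) \<and> states S t \<noteq> {} \<and>
        finite (actions S t) \<and> actions S t \<noteq> {} \<and>
        finite (disturbances S t) \<and> disturbances S t \<noteq> {} \<and>
        finite (noises S t) \<and> noises S t \<noteq> {} \<and>
        finite (observations S t) \<and> observations S t \<noteq> {}) \<and>
     (\<forall>t<horizon S. \<forall>x\<in>states S t. \<forall>u\<in>actions S t. \<forall>w\<in>disturbances S t.
        dyn S t x u w \<in> states S (Suc t)) \<and>
     (\<forall>t\<le>horizon S. \<forall>x\<in>states S t. \<forall>n\<in>noises S t. obs S t x n \<in> observations S t) \<and>
     (\<forall>x\<in>states S (horizon S). \<forall>u\<in>actions S (horizon S). 0 \<le> cost S x u)"

text \<open>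
  A sample is a tuple \<open>(x\<^sub>0, w, n, u)\<close>. The last three components are extensional functions on
  \<open>{..horizon}\<close>, so distinct samples differ at some time up to the horizon.
\<close>

type_synonym ('x, 'u, 'w, 'n) sample = "'x \<times> (nat \<Rightarrow> 'w) \<times> (nat \<Rightarrow> 'n) \<times> (nat \<Rightarrow> 'u)"

definition sample_space ::
    "('x, 'u, 'w, 'n, 'y) control_system \<Rightarrow> ('x, 'u, 'w, 'n) sample set" where
  "sample_space S =
     states S 0 \<times> (\<Pi>\<^sub>E t\<in>{..horizon S}. disturbances S t)
       \<times> (\<Pi>\<^sub>E t\<in>{..horizon S}. noises S t) \<times> (\<Pi>\<^sub>E t\<in>{..horizon S}. actions S t)"

fun state :: "('x, 'u, 'w, 'n, 'y) control_system \<Rightarrow> nat \<Rightarrow> ('x, 'u, 'w, 'n) sample \<Rightarrow> 'x" where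
  "state S 0 (x0, w, n, u) = x0"
| "state S (Suc t) (x0, w, n, u) = dyn S t (state S t (x0, w, n, u)) (u t) (w t)"

fun action :: "nat \<Rightarrow> ('x, 'u, 'w, 'n) sample \<Rightarrow> 'u" where
  "action t (x0, w, n, u) = u t"

fun observation ::
    "('x, 'u, 'w, 'n, 'y) control_system \<Rightarrow> nat \<Rightarrow> ('x, 'u, 'w, 'n) sample \<Rightarrow> 'y" where
  "observation S t (x0, w, n, u) = obs S t (state S t (x0, w, n, u)) (n t)"

text \<open>The memory \<open>(Y\<^sub>0, \<dots>, Y\<^sub>t)\<close>, \<open>(U\<^sub>0, \<dots>, U\<^sub>t\<^sub>-\<^sub>1)\<close> as a pair of lists of lengths \<open>t + 1\<close> and \<open>t\<close>.\<close>

definition memory ::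
    "('x, 'u, 'w, 'n, 'y) control_system \<Rightarrow> nat \<Rightarrow> ('x, 'u, 'w, 'n) sample
      \<Rightarrow> 'y list \<times> 'u list" where
  "memory S t \<omega> = (map (\<lambda>s. observation S s \<omega>) [0..<Suc t], map (\<lambda>s. action s \<omega>) [0..<t])"

definition memories :: "('x, 'u, 'w, 'n, 'y) control_system \<Rightarrow> nat \<Rightarrow> ('y list \<times> 'u list) set" where
  "memories S t = memory S t ` sample_space S"

text \<open>
  \<open>cond_range S A B b\<close> is the conditional range \<open>[[A | b]]\<close> of \<open>A\<close> given the realization \<open>b\<close> of \<open>B\<close>.
  Joint conditioning uses a pair-valued \<open>B\<close>.
\<close>

definition cond_range ::
    "('x, 'u, 'w, 'n, 'y) control_system \<Rightarrow> (('x, 'u, 'w, 'n) sample \<Rightarrow> 'a)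
      \<Rightarrow> (('x, 'u, 'w, 'n) sample \<Rightarrow> 'b) \<Rightarrow> 'b \<Rightarrow> 'a set" where
  "cond_range S A B b = A ` {\<omega> \<in> sample_space S. B \<omega> = b}"

text \<open>
  In the value functions, the terminal branch is meant for \<open>t = horizon S\<close>; later times are
  only there to make the functions total.
\<close>

function Q_mem :: "('x, 'u, 'w, 'n, 'y) control_system \<Rightarrow> nat \<Rightarrow> 'y list \<times> 'u list \<Rightarrow> 'u \<Rightarrow> real"
  and V_mem :: "('x, 'u, 'w, 'n, 'y) control_system \<Rightarrow> nat \<Rightarrow> 'y list \<times> 'u list \<Rightarrow> real" where
  "Q_mem S t m u =
     (if t < horizon S
      then Max ((\<lambda>m'. V_mem S (Suc t) m') `
             cond_range S (memory S (Suc t)) (\<lambda>\<omega>. (memory S t \<omega>, action t \<omega>)) (m, u))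
      else Max ((\<lambda>x. cost S x u) `
             cond_range S (state S (horizon S)) (memory S (horizon S)) m))"
| "V_mem S t m = Min ((\<lambda>u. Q_mem S t m u) ` actions S t)"
  by pat_completeness auto
termination
  by (relation "measure (\<lambda>p. case p of
        Inl (S, t, m, u) \<Rightarrow> 2 * (horizon S - t)
      | Inr (S, t, m) \<Rightarrow> Suc (2 * (horizon S - t)))") auto

definition info ::
    "('x, 'u, 'w, 'n, 'y) control_system \<Rightarrow> (nat \<Rightarrow> 'y list \<times> 'u list \<Rightarrow> 'p) \<Rightarrow> nat
      \<Rightarrow> ('x, 'u, 'w, 'n) sample \<Rightarrow> 'p" where
  "info S \<sigma> t \<omega> = \<sigma> t (memory S t \<omega>)"

definition information_state ::
    "('x, 'u, 'w, 'n, 'y) control_system \<Rightarrow> (nat \<Rightarrow> 'p set)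
      \<Rightarrow> (nat \<Rightarrow> 'y list \<times> 'u list \<Rightarrow> 'p) \<Rightarrow> bool" where
  "information_state S P \<sigma> \<longleftrightarrow>
     (\<forall>t\<le>horizon S. finite (P t) \<and> (\<forall>m\<in>memories S t. \<sigma> t m \<in> P t)) \<and>
     (\<forall>m\<in>memories S (horizon S). \<forall>u\<in>actions S (horizon S).
        Max ((\<lambda>x. cost S x u) `
          cond_range S (state S (horizon S)) (memory S (horizon S)) m) =
        Max ((\<lambda>x. cost S x u) `
          cond_range S (state S (horizon S)) (info S \<sigma> (horizon S)) (\<sigma> (horizon S) m))) \<and>
     (\<forall>t<horizon S. \<forall>m\<in>memories S t. \<forall>u\<in>actions S t.
        cond_range S (info S \<sigma> (Suc t)) (\<lambda>\<omega>. (memory S t \<omega>, action t \<omega>)) (m, u) =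
        cond_range S (info S \<sigma> (Suc t)) (\<lambda>\<omega>. (info S \<sigma> t \<omega>, action t \<omega>)) (\<sigma> t m, u))"

function Q_info :: "('x, 'u, 'w, 'n, 'y) control_system \<Rightarrow> (nat \<Rightarrow> 'y list \<times> 'u list \<Rightarrow> 'p)
      \<Rightarrow> nat \<Rightarrow> 'p \<Rightarrow> 'u \<Rightarrow> real"
  and V_info :: "('x, 'u, 'w, 'n, 'y) control_system \<Rightarrow> (nat \<Rightarrow> 'y list \<times> 'u list \<Rightarrow> 'p)
      \<Rightarrow> nat \<Rightarrow> 'p \<Rightarrow> real" where
  "Q_info S \<sigma> t \<pi> u =
     (if t < horizon S
      then Max ((\<lambda>\<pi>'. V_info S \<sigma> (Suc t) \<pi>') `
             cond_range S (info S \<sigma> (Suc t)) (\<lambda>\<omega>. (info S \<sigma> t \<omega>, action t \<omega>)) (\<pi>, u))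
      else Max ((\<lambda>x. cost S x u) `
             cond_range S (state S (horizon S)) (info S \<sigma> (horizon S)) \<pi>))"
| "V_info S \<sigma> t \<pi> = Min ((\<lambda>u. Q_info S \<sigma> t \<pi> u) ` actions S t)"
  by pat_completeness auto
termination
  by (relation "measure (\<lambda>p. case p of
        Inl (S, \<sigma>, t, \<pi>, u) \<Rightarrow> 2 * (horizon S - t)
      | Inr (S, \<sigma>, t, \<pi>) \<Rightarrow> Suc (2 * (horizon S - t)))") auto

text \<open>The defining equations are not left-reducing, so they must not be used as default rewrite rules.\<close>

declare Q_mem.simps [simp del] V_mem.simps [simp del] Q_info.simps [simp del] V_info.simps [simp del]

end

theory Submission
  imports Defs
begin

text \<open>
  Backward induction on \<open>t\<close>. By the induction hypothesis \<open>V_mem\<close> at time \<open>t + 1\<close> factors through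
  \<open>\<sigma>\<close>, so the maximum over the range of the next memory is a maximum over the range of the next
  information state given \<open>(m, u)\<close>; by the second defining condition of an information state,
  that range depends on \<open>m\<close> only through \<open>\<sigma> t m\<close>.
\<close>

lemma V_eqI:
  assumes "\<And>u. u \<in> actions S t \<Longrightarrow> Q_mem S t m u = Q_info S \<sigma> t p u"
  shows "V_mem S t m = V_info S \<sigma> t p"
  using assms by (simp add: V_mem.simps V_info.simps cong: image_cong_simp)

text \<open>Both sides unfold to terminal maxima, which the terminal-cost condition of an
  information state equates.\<close>

lemma Q_mem_eq_Q_info_horizon:
  assumes "information_state S P \<sigma>" and "m \<in> memories S (horizon S)"
    and "u \<in> actions S (horizon S)"
  shows "Q_mem S (horizon S) m u = Q_info S \<sigma> (horizon S) (\<sigma> (horizon S) m) u"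
  using assms by (simp add: information_state_def Q_mem.simps Q_info.simps)

lemma Q_mem_eq_Q_info_step:
  assumes info: "information_state S P \<sigma>" and t: "t < horizon S"
    and m: "m \<in> memories S t" and u: "u \<in> actions S t"
    and V: "\<And>m'. m' \<in> memories S (Suc t) \<Longrightarrow> V_mem S (Suc t) m' = V_info S \<sigma> (Suc t) (\<sigma> (Suc t) m')"
  shows "Q_mem S t m u = Q_info S \<sigma> t (\<sigma> t m) u"
proof -
  let ?B = "\<lambda>\<omega>. (memory S t \<omega>, action t \<omega>)"
  have "V_mem S (Suc t) ` cond_range S (memory S (Suc t)) ?B (m, u)
      = V_info S \<sigma> (Suc t) ` cond_range S (info S \<sigma> (Suc t)) ?B (m, u)"
    \<comment> \<open>Both sides become images of one set of samples, on which \<open>info\<close>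
      is \<open>\<sigma>\<close> of \<open>memory\<close>, so \<open>V\<close> applies sample by
      sample.\<close>
    unfolding cond_range_def image_image
    by (rule image_cong) (auto simp: info_def memories_def intro!: V)
  also have "cond_range S (info S \<sigma> (Suc t)) ?B (m, u)
      = cond_range S (info S \<sigma> (Suc t)) (\<lambda>\<omega>. (info S \<sigma> t \<omega>, action t \<omega>)) (\<sigma> t m, u)"
    using info t m u unfolding information_state_def by blast
  finally show ?thesis
    using t by (simp add: Q_mem.simps[of S t] Q_info.simps[of S \<sigma> t])
qed

theorem theorem1:
  fixes S :: "('x, 'u, 'w, 'n, 'y) control_system"
    and P :: "nat \<Rightarrow> 'p set"
    and \<sigma> :: "nat \<Rightarrow> 'y list \<times> 'u list \<Rightarrow> 'p"
  assumes "valid_system S"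
    and "information_state S P \<sigma>"
  shows "\<forall>t\<le>horizon S. \<forall>m\<in>memories S t. \<forall>u\<in>actions S t.
           Q_mem S t m u = Q_info S \<sigma> t (\<sigma> t m) u \<and>
           V_mem S t m = V_info S \<sigma> t (\<sigma> t m)"
proof -
  have "\<forall>m\<in>memories S t. \<forall>u\<in>actions S t. Q_mem S t m u = Q_info S \<sigma> t (\<sigma> t m) u"
    if "t \<le> horizon S" for t
    using that
  proof (induction t rule: inc_induct)
    case base
    show ?case
      using Q_mem_eq_Q_info_horizon[OF assms(2)] by blast
  next
    case (step t)
    have "V_mem S (Suc t) m' = V_info S \<sigma> (Suc t) (\<sigma> (Suc t) m')"
      if "m' \<in> memories S (Suc t)" for m'
      using step.IH that by (intro V_eqI) blast
    then show ?case
      using Q_mem_eq_Q_info_step[OF assms(2) step.hyps(2)] by blast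
  qed
  then show ?thesis
    \<comment> \<open>The induction carries only the \<open>Q\<close> equation; at each time it
      yields the \<open>V\<close> equation by minimising over actions.\<close>
    by (intro allI impI ballI conjI V_eqI) blast+
qed

end
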